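(* Let $d\ge1$ and $\varepsilon\in(0,1)$ with $\varepsilon^{-1}\in\mathbb N$. For all $u_0^\varepsilon\in\mathbb R^{\mathbb T_\varepsilon^d}$ and $t>0$, the averaging process $(u_t^\varepsilon)_{t\ge0}$ on $\mathbb T_\varepsilon^d$ started from $u_0^\varepsilon$ satisfies $$\mathbb E\big[\|u_t^\varepsilon\|_{H^1(\mathbb T_\varepsilon^d)}^2\big]\le2\,\|u_0^\varepsilon\|_{H^1(\mathbb T_\varepsilon^d)}^2.$$
   Context: $\mathbb T_\varepsilon^d=(\varepsilon\mathbb Z/\mathbb Z)^d$ is the discrete torus with mesh $\varepsilon$; $e_1,\dots,e_d$ is the canonical basis. Let $(N_t^{\varepsilon,i}(x))_{t\ge0}$, $x\in\mathbb T_\varepsilon^d$, $i=1,\dots,d$, be i.i.d. Poisson processes of intensity $\varepsilon^{-2}$, with expectation $\mathbb E$. The averaging process started from a deterministic $u_0^\varepsilon$ is the càdlàg process which, at each arrival time $t$ of $N^{\varepsilon,i}(x)$, replaces both $u_{t^-}^\varepsilon(x)$ and $u_{t^-}^\varepsilon(x+\varepsilon e_i)$ with $\tfrac12(u_{t^-}^\varepsilon(x)+u_{t^-}^\varepsilon(x+\varepsilon e_i))$, leaves the other values unchanged, and is constant between arrivals. With $\nabla^{\varepsilon,i}h(x)=\varepsilon^{-1}(h(x+\varepsilon e_i)-h(x))$, the (semi)norm is $\|h\|_{H^1(\mathbb T_\varepsilon^d)}=\big(\varepsilon^d\sum_{x\in\mathbb T_\varepsilon^d}\sum_{i=1}^d|\nabla^{\varepsilon,i}h(x)|^2\big)^{1/2}$.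 *)

theory Defs
  imports "HOL-Probability.Probability"
begin

text \<open>
  The torus \<open>(\<epsilon>\<int>/\<int>)\<^sup>d\<close> is represented by the representatives in \<open>[0,1)\<^sup>d\<close>; the dimension
  is \<open>d = CARD('d)\<close>, which is at least 1 for every index type.
\<close>

definition torus :: "real \<Rightarrow> (real ^ 'd::finite) set" where
  "torus \<epsilon> = {x. \<forall>j. 0 \<le> x $ j \<and> x $ j < 1 \<and> (\<exists>k::int. x $ j = \<epsilon> * of_int k)}"

text \<open>The neighbour \<open>x + \<epsilon> e\<^sub>i\<close> modulo 1.\<close>

definition shift :: "real \<Rightarrow> 'd::finite \<Rightarrow> real ^ 'd \<Rightarrow> real ^ 'd" where
  "shift \<epsilon> i x = (\<chi> j. frac ((x + \<epsilon> *\<^sub>R axis i 1) $ j))"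

definition grad :: "real \<Rightarrow> 'd::finite \<Rightarrow> (real ^ 'd \<Rightarrow> real) \<Rightarrow> real ^ 'd \<Rightarrow> real" where
  "grad \<epsilon> i h x = (h (shift \<epsilon> i x) - h x) / \<epsilon>"

definition H1_norm :: "real \<Rightarrow> (real ^ 'd::finite \<Rightarrow> real) \<Rightarrow> real" where
  "H1_norm \<epsilon> h =
    sqrt (\<epsilon> ^ CARD('d) * (\<Sum>x\<in>torus \<epsilon>. \<Sum>i\<in>UNIV. \<bar>grad \<epsilon> i h x\<bar>\<^sup>2))"

text \<open>
  Time is \<open>[0,\<infinity>)\<close>; values at negative times are irrelevant. Path properties are required
  almost surely. The increments are differences of natural numbers, but truncation only
  occurs on the null set where the path is not monotone.
\<close>

definition poisson_process :: "'w measure \<Rightarrow> real \<Rightarrow> (real \<Rightarrow> 'w \<Rightarrow> nat) \<Rightarrow> bool" where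
  "poisson_process M r N \<longleftrightarrow>
    (\<forall>t\<ge>0. N t \<in> measurable M (count_space UNIV)) \<and>
    (AE \<omega> in M. N 0 \<omega> = 0 \<and> mono_on {0..} (\<lambda>t. N t \<omega>) \<and>
       (\<forall>t\<ge>0. continuous (at_right t) (\<lambda>s. N s \<omega>))) \<and>
    (\<forall>s t. 0 \<le> s \<longrightarrow> s < t \<longrightarrow>
       distr M (count_space UNIV) (\<lambda>\<omega>. N t \<omega> - N s \<omega>) = measure_pmf (poisson_pmf (r * (t - s)))) \<and>
    (\<forall>\<tau>::nat \<Rightarrow> real. \<forall>n. 0 \<le> \<tau> 0 \<longrightarrow> strict_mono \<tau> \<longrightarrow>
       prob_space.indep_vars M (\<lambda>_. count_space UNIV)
         (\<lambda>k \<omega>. N (\<tau> (Suc k)) \<omega> - N (\<tau> k) \<omega>) {..<n})"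

text \<open>Independence is that of the whole processes, as random elements of the path space.\<close>

definition iid_poisson_processes ::
  "'w measure \<Rightarrow> real \<Rightarrow> 'i set \<Rightarrow> ('i \<Rightarrow> real \<Rightarrow> 'w \<Rightarrow> nat) \<Rightarrow> bool" where
  "iid_poisson_processes M r I N \<longleftrightarrow>
    (\<forall>p\<in>I. poisson_process M r (N p)) \<and>
    prob_space.indep_vars M (\<lambda>_. Pi\<^sub>M {0..} (\<lambda>_. count_space UNIV))
      (\<lambda>p \<omega>. \<lambda>t\<in>{0..}. N p t \<omega>) I"

definition arrival :: "(real \<Rightarrow> nat) \<Rightarrow> real \<Rightarrow> bool" where
  "arrival n t \<longleftrightarrow> 0 < t \<and> (\<forall>s. 0 \<le> s \<longrightarrow> s < t \<longrightarrow> n s < n t)"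

definition cadlag :: "(real \<Rightarrow> real) \<Rightarrow> bool" where
  "cadlag f \<longleftrightarrow> (\<forall>t\<ge>0. continuous (at_right t) f) \<and> (\<forall>t>0. \<exists>l. (f \<longlongrightarrow> l) (at_left t))"

definition left_lim :: "(real \<Rightarrow> real) \<Rightarrow> real \<Rightarrow> real" where
  "left_lim f t = Lim (at_left t) f"

text \<open>
  The path \<open>u\<close> driven by a single realisation \<open>n\<close> of the clocks; \<open>n i x\<close> is the clock of the
  bond between \<open>x\<close> and \<open>x + \<epsilon> e\<^sub>i\<close>.
\<close>

definition averaging_path ::
  "real \<Rightarrow> ('d::finite \<Rightarrow> real ^ 'd \<Rightarrow> real \<Rightarrow> nat) \<Rightarrow> (real ^ 'd \<Rightarrow> real) \<Rightarrow>
   (real \<Rightarrow> real ^ 'd \<Rightarrow> real) \<Rightarrow> bool" where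
  "averaging_path \<epsilon> n u\<^sub>0 u \<longleftrightarrow>
    (\<forall>x\<in>torus \<epsilon>. u 0 x = u\<^sub>0 x) \<and>
    (\<forall>x\<in>torus \<epsilon>. cadlag (\<lambda>t. u t x)) \<and>
    (\<forall>x\<in>torus \<epsilon>. \<forall>i t. arrival (n i x) t \<longrightarrow>
      (\<forall>y\<in>torus \<epsilon>. u t y =
        (if y = x \<or> y = shift \<epsilon> i x
         then (left_lim (\<lambda>s. u s x) t + left_lim (\<lambda>s. u s (shift \<epsilon> i x)) t) / 2
         else left_lim (\<lambda>s. u s y) t))) \<and>
    (\<forall>s t. 0 \<le> s \<longrightarrow> s < t \<longrightarrow>
      (\<forall>x\<in>torus \<epsilon>. \<forall>i. \<forall>r\<in>{s<..t}. \<not> arrival (n i x) r) \<longrightarrow>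
      (\<forall>y\<in>torus \<epsilon>. u t y = u s y))"

text \<open>
  Almost surely no two clocks ring simultaneously, but on the exceptional null set the
  updating rule can be contradictory, so it is only imposed almost surely.
\<close>

definition averaging_process ::
  "'w measure \<Rightarrow> real \<Rightarrow> ('d::finite \<Rightarrow> real ^ 'd \<Rightarrow> real \<Rightarrow> 'w \<Rightarrow> nat) \<Rightarrow>
   (real ^ 'd \<Rightarrow> real) \<Rightarrow> (real \<Rightarrow> 'w \<Rightarrow> real ^ 'd \<Rightarrow> real) \<Rightarrow> bool" where
  "averaging_process M \<epsilon> N u\<^sub>0 u \<longleftrightarrow>
    (\<forall>t\<ge>0. \<forall>x\<in>torus \<epsilon>. (\<lambda>\<omega>. u t \<omega> x) \<in> borel_measurable M) \<and>
    (AE \<omega> in M. averaging_path \<epsilon> (\<lambda>i x t. N i x t \<omega>) u\<^sub>0 (\<lambda>t. u t \<omega>))"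

end

theory Submission
  imports Defs
begin

text \<open>
  Let \<open>P\<^sub>b\<close> be the averaging over the bond \<open>b\<close>, and let
  \<open>S(u,v) = \<Sum>\<^sub>w \<langle>u, v(\<cdot> + w)\<rangle>\<^sup>2\<close>. Since \<open>P\<^sub>b\<close> is self-adjoint and translations permute the bonds,
  \<open>\<Sum>\<^sub>b S(P\<^sub>b u, v) = \<Sum>\<^sub>b S(u, P\<^sub>b v)\<close>: the averaging dynamics is self-dual for \<open>S\<close>, and so for
  its drift \<open>R(u,v) = \<Sum>\<^sub>b (S(P\<^sub>b u, v) - S(u,v))\<close>. If \<open>v\<close> is a point mass, then \<open>S(u,v)\<close> is the square
  of the \<open>L\<^sup>2\<close> norm of \<open>u\<close> and \<open>R(u,v)\<close> is \<open>-1/2\<close> times the Dirichlet energy of \<open>u\<close>. If \<open>v\<close> is any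
  probability vector, summation by parts and Jensen's inequality give \<open>R(u,v) \<ge> -E\<close>, where \<open>E\<close>
  is that energy. Running the dynamics on the point mass instead of on \<open>u\<^sub>0\<close> yields the factor 2.

  This applies to every word of bonds with product weights. To reach the Poisson clocks, cut \<open>[0,t]\<close>
  into \<open>m\<close> equal intervals: if at most one clock rings in each of them, \<open>u\<^sub>t\<close> is the result of a word that
  is read off the clock increments, and the probability of that event tends to 1, while \<open>u\<^sub>t\<close> stays bounded.
\<close>

section \<open>Averaging words\<close>

text \<open>The group structure of the torus is recorded through permutations of \<open>V\<close>:
  translation is bijective in each argument, and a unit shift of either argument shifts the
  result.\<close>

locale torus_shifts =
  fixes V :: "'a set" and s :: "'i::finite \<Rightarrow> 'a \<Rightarrow> 'a" and add :: "'a \<Rightarrow> 'a \<Rightarrow> 'a"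
  assumes finite_V: "finite V"
    and V_nonempty: "V \<noteq> {}"
    and bij_shift: "bij_betw (s i) V V"
    and shift_neq: "x \<in> V \<Longrightarrow> s i x \<noteq> x"
    and bij_add_left: "w \<in> V \<Longrightarrow> bij_betw (\<lambda>x. add x w) V V"
    and bij_add_right: "x \<in> V \<Longrightarrow> bij_betw (add x) V V"
    and add_shift_left: "\<lbrakk>x \<in> V; w \<in> V\<rbrakk> \<Longrightarrow> add (s i x) w = s i (add x w)"
    and add_shift_right: "\<lbrakk>x \<in> V; w \<in> V\<rbrakk> \<Longrightarrow> add x (s i w) = s i (add x w)"
begin

lemma shift_closed: "x \<in> V \<Longrightarrow> s i x \<in> V"
  using bij_shift bij_betwE by blast

lemma add_closed: "x \<in> V \<Longrightarrow> w \<in> V \<Longrightarrow> add x w \<in> V"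
  using bij_add_right bij_betwE by blast

lemma sum_shift: "(\<Sum>x\<in>V. f (s i x)) = sum f V"
  by (rule sum.reindex_bij_betw[OF bij_shift])

lemma sum_add_left: "w \<in> V \<Longrightarrow> (\<Sum>x\<in>V. f (add x w)) = sum f V"
  by (rule sum.reindex_bij_betw[OF bij_add_left])

lemma sum_add_right: "x \<in> V \<Longrightarrow> (\<Sum>w\<in>V. f (add x w)) = sum f V"
  by (rule sum.reindex_bij_betw[OF bij_add_right])

text \<open>A bond is labelled by direction and base point, so that on the torus of mesh 1/2, where
  \<open>(i, x)\<close> and \<open>(i, s i x)\<close> join the same two sites, both are
  counted.\<close>

definition bonds :: "('i \<times> 'a) set" where
  "bonds = UNIV \<times> V"

text \<open>The letter \<open>None\<close> stands for a time interval in which no clock rings.\<close>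

definition letters :: "('i \<times> 'a) option set" where
  "letters = insert None (Some ` bonds)"

fun relax :: "('i \<times> 'a) option \<Rightarrow> ('a \<Rightarrow> real) \<Rightarrow> 'a \<Rightarrow> real" where
  "relax None u = u"
| "relax (Some (i, x)) u = (\<lambda>y. if y = x \<or> y = s i x then (u x + u (s i x)) / 2 else u y)"

definition run :: "('i \<times> 'a) option list \<Rightarrow> ('a \<Rightarrow> real) \<Rightarrow> 'a \<Rightarrow> real" where
  "run = fold relax"

definition energy :: "('a \<Rightarrow> real) \<Rightarrow> real" where
  "energy u = (\<Sum>x\<in>V. \<Sum>i\<in>UNIV. (u (s i x) - u x)\<^sup>2)"

text \<open>Cross-correlation of \<open>u\<close> and \<open>v\<close> at lag \<open>w\<close>.
  Below, \<open>overlap\<close> and \<open>drift\<close> are the S and R of the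
  introduction.\<close>

definition corr :: "('a \<Rightarrow> real) \<Rightarrow> ('a \<Rightarrow> real) \<Rightarrow> 'a \<Rightarrow> real" where
  "corr u v w = (\<Sum>x\<in>V. u x * v (add x w))"

definition overlap :: "('a \<Rightarrow> real) \<Rightarrow> ('a \<Rightarrow> real) \<Rightarrow> real" where
  "overlap u v = (\<Sum>w\<in>V. (corr u v w)\<^sup>2)"

definition drift :: "('a \<Rightarrow> real) \<Rightarrow> ('a \<Rightarrow> real) \<Rightarrow> real" where
  "drift u v = (\<Sum>b\<in>bonds. overlap (relax (Some b) u) v - overlap u v)"

lemma finite_bonds: "finite bonds"
  by (simp add: bonds_def finite_V)

lemma finite_letters: "finite letters"
  by (simp add: letters_def finite_bonds)

lemma sum_letters: "(\<Sum>a\<in>letters. f a) = f None + (\<Sum>b\<in>bonds. f (Some b))"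
  unfolding letters_def
  by (subst sum.insert) (auto simp: finite_bonds sum.reindex)

lemma sum_bonds: "(\<Sum>b\<in>bonds. f b) = (\<Sum>i\<in>UNIV. \<Sum>x\<in>V. f (i, x))"
  unfolding bonds_def by (rule sum.cartesian_product')

lemma energy_nonneg: "energy u \<ge> 0"
  unfolding energy_def by (intro sum_nonneg) auto

lemma energy_bonds: "energy u = (\<Sum>(i, x)\<in>bonds. (u (s i x) - u x)\<^sup>2)"
  unfolding energy_def bonds_def
  by (subst sum.swap) (simp add: sum.cartesian_product)

text \<open>The two end values move by opposite halves of their difference. The correction is
  symmetric in \<open>u\<close> and \<open>g\<close>, which is self-adjointness;
  \<open>g = 1\<close> gives conservation of mass.\<close>

lemma inner_relax:
  assumes "x \<in> V"
  shows "(\<Sum>y\<in>V. relax (Some (i, x)) u y * g y) =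
    (\<Sum>y\<in>V. u y * g y) - (u (s i x) - u x) * (g (s i x) - g x) / 2"
proof -
  have "relax (Some (i, x)) u y * g y = u y * g y +
      ((if y = x then (u (s i x) - u x) / 2 * g x else 0) +
       (if y = s i x then (u x - u (s i x)) / 2 * g (s i x) else 0))" for y
    using shift_neq[OF assms, of i] by (auto simp: field_simps)
  then have "(\<Sum>y\<in>V. relax (Some (i, x)) u y * g y) = (\<Sum>y\<in>V. u y * g y) +
      ((u (s i x) - u x) / 2 * g x + (u x - u (s i x)) / 2 * g (s i x))"
    using assms shift_closed[OF assms] by (simp add: sum.distrib finite_V)
  then show ?thesis
    by (simp add: field_simps)
qed

section \<open>Self-duality of overlap and drift\<close>

lemma relax_translate:
  assumes "x \<in> V" "w \<in> V" "y \<in> V"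
  shows "relax (Some (i, add x w)) v (add y w) = relax (Some (i, x)) (\<lambda>z. v (add z w)) y"
proof -
  have inj: "inj_on (\<lambda>z. add z w) V"
    using bij_add_left[OF assms(2)] by (simp add: bij_betw_def)
  \<comment> \<open>By injectivity, \<open>add y w\<close> is an endpoint of the translated bond
    exactly when \<open>y\<close> is one of the original bond.\<close>
  have "add y w = add z w \<longleftrightarrow> y = z" if "z \<in> V" for z
    using inj that assms by (auto dest: inj_onD)
  then show ?thesis
    using assms shift_closed by (simp flip: add_shift_left)
qed

lemma corr_relax_left:
  assumes "x \<in> V" "w \<in> V"
  shows "corr (relax (Some (i, x)) u) v w =
    corr u v w - (u (s i x) - u x) * (v (add (s i x) w) - v (add x w)) / 2"
  unfolding corr_def using inner_relax[OF assms(1), of i u "\<lambda>y. v (add y w)"] by simp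

text \<open>Self-adjointness moves the averaging from \<open>u\<close> to \<open>v\<close>, where at
  lag \<open>w\<close> it acts on the bond translated by \<open>w\<close>.\<close>

lemma corr_relax_right:
  assumes "x \<in> V" "w \<in> V"
  shows "corr u (relax (Some (i, add x w)) v) w = corr (relax (Some (i, x)) u) v w"
proof -
  have "corr u (relax (Some (i, add x w)) v) w =
      (\<Sum>y\<in>V. relax (Some (i, x)) (\<lambda>z. v (add z w)) y * u y)"
    unfolding corr_def using relax_translate assms by (intro sum.cong) (simp_all add: mult.commute)
  then show ?thesis
    unfolding corr_relax_left[OF assms] inner_relax[OF assms(1)] by (simp add: corr_def mult.commute)
qed

text \<open>At a fixed lag, passing from \<open>u\<close> to \<open>v\<close> translates the bond by
  that lag; summing over all base points absorbs the translation.\<close>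

lemma sum_overlap_relax:
  "(\<Sum>b\<in>bonds. overlap (relax (Some b) u) v) = (\<Sum>b\<in>bonds. overlap u (relax (Some b) v))"
proof -
  have "(\<Sum>b\<in>bonds. overlap (relax (Some b) u) v) =
      (\<Sum>i\<in>UNIV. \<Sum>w\<in>V. \<Sum>x\<in>V. (corr (relax (Some (i, x)) u) v w)\<^sup>2)"
    unfolding sum_bonds overlap_def by (intro sum.cong refl sum.swap)
  also have "\<dots> = (\<Sum>i\<in>UNIV. \<Sum>w\<in>V. \<Sum>x\<in>V. (corr u (relax (Some (i, add x w)) v) w)\<^sup>2)"
    using corr_relax_right by (intro sum.cong) simp_all
  also have "\<dots> = (\<Sum>i\<in>UNIV. \<Sum>w\<in>V. \<Sum>x\<in>V. (corr u (relax (Some (i, x)) v) w)\<^sup>2)"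
    by (intro sum.cong refl sum_add_left[where f = "\<lambda>x. (corr u (relax (Some (_, x)) v) _)\<^sup>2"])
  also have "\<dots> = (\<Sum>b\<in>bonds. overlap u (relax (Some b) v))"
    unfolding sum_bonds overlap_def by (intro sum.cong refl sum.swap)
  finally show ?thesis .
qed

lemma drift_right: "drift u v = (\<Sum>b\<in>bonds. overlap u (relax (Some b) v) - overlap u v)"
  unfolding drift_def by (simp add: sum_subtractf sum_overlap_relax)

text \<open>Expanding the left drift through \<open>v\<close> and the right drift through
  \<open>u\<close> produces the same double sum over two bonds; the subtracted terms agree by
  \<open>sum_overlap_relax\<close>.\<close>

lemma sum_drift_relax:
  "(\<Sum>b\<in>bonds. drift (relax (Some b) u) v) = (\<Sum>b\<in>bonds. drift u (relax (Some b) v))"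
proof -
  have "(\<Sum>b\<in>bonds. drift (relax (Some b) u) v) =
      (\<Sum>b\<in>bonds. \<Sum>b'\<in>bonds. overlap (relax (Some b) u) (relax (Some b') v))
        - card bonds * (\<Sum>b\<in>bonds. overlap (relax (Some b) u) v)"
    by (simp add: drift_right sum_subtractf sum_distrib_left)
  also have "\<dots> = (\<Sum>b'\<in>bonds. \<Sum>b\<in>bonds. overlap (relax (Some b) u) (relax (Some b') v))
        - card bonds * (\<Sum>b\<in>bonds. overlap u (relax (Some b) v))"
    by (subst sum.swap) (simp add: sum_overlap_relax)
  also have "\<dots> = (\<Sum>b\<in>bonds. drift u (relax (Some b) v))"
    by (simp add: drift_def sum_subtractf sum_distrib_left)
  finally show ?thesis .
qed

section \<open>Lower bound for the drift\<close>

lemma corr_shift: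
  assumes "w \<in> V"
  shows "corr (\<lambda>x. u (s i x) - u x) v (s i w) = corr u v w - corr u v (s i w)"
proof -
  \<comment> \<open>A shift of the lag is traded for a shift of \<open>x\<close>, which reindexing
    then removes.\<close>
  have "(\<Sum>x\<in>V. u (s i x) * v (add x (s i w))) = (\<Sum>x\<in>V. u (s i x) * v (add (s i x) w))"
    using assms by (intro sum.cong) (simp_all add: add_shift_left add_shift_right)
  also have "\<dots> = corr u v w"
    unfolding corr_def by (rule sum_shift)
  finally show ?thesis
    by (simp add: corr_def left_diff_distrib sum_subtractf)
qed

text \<open>Summation by parts in the translation variable turns the first-order part of the drift
  into a sum of squares.\<close>

lemma sum_corr_by_parts:
  "(\<Sum>w\<in>V. corr u v w * (\<Sum>x\<in>V. (u (s i x) - u x) * (v (add (s i x) w) - v (add x w)))) =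
    (\<Sum>w\<in>V. (corr (\<lambda>x. u (s i x) - u x) v w)\<^sup>2)"
proof -
  define H where "H = corr (\<lambda>x. u (s i x) - u x) v"
  have "(\<Sum>x\<in>V. (u (s i x) - u x) * (v (add (s i x) w) - v (add x w))) = H (s i w) - H w"
    if "w \<in> V" for w
    unfolding H_def corr_def using that
    by (simp add: right_diff_distrib sum_subtractf add_shift_left add_shift_right)
  then have "(\<Sum>w\<in>V. corr u v w * (\<Sum>x\<in>V. (u (s i x) - u x) * (v (add (s i x) w) - v (add x w)))) =
      (\<Sum>w\<in>V. corr u v w * H (s i w)) - (\<Sum>w\<in>V. corr u v w * H w)"
    by (simp add: right_diff_distrib sum_subtractf)
  \<comment> \<open>Reindexing gives both sums the factor \<open>H (s i w)\<close>; the difference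
    of the other factors is \<open>H (s i w)\<close> again, by \<open>corr_shift\<close>.\<close>
  also have "(\<Sum>w\<in>V. corr u v w * H w) = (\<Sum>w\<in>V. corr u v (s i w) * H (s i w))"
    by (rule sum_shift[symmetric])
  also have "(\<Sum>w\<in>V. corr u v w * H (s i w)) - (\<Sum>w\<in>V. corr u v (s i w) * H (s i w)) =
      (\<Sum>w\<in>V. (H (s i w))\<^sup>2)"
    unfolding sum_subtractf[symmetric]
    by (intro sum.cong) (simp_all add: H_def corr_shift power2_eq_square left_diff_distrib)
  also have "\<dots> = (\<Sum>w\<in>V. (H w)\<^sup>2)"
    by (rule sum_shift)
  finally show ?thesis
    unfolding H_def .
qed

text \<open>\<open>corr g v w\<close> is a mean of \<open>g\<close> with weights
  \<open>v (add x w)\<close>. These sum to 1 over \<open>x\<close>, so Jensen's inequality (here via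
  Cauchy-Schwarz) applies, and to 1 over \<open>w\<close>, which collapses the outer sum.\<close>

lemma sum_corr_square_le:
  assumes v: "\<And>x. x \<in> V \<Longrightarrow> v x \<ge> 0" "sum v V = 1"
  shows "(\<Sum>w\<in>V. (corr g v w)\<^sup>2) \<le> (\<Sum>x\<in>V. (g x)\<^sup>2)"
proof -
  have "(\<Sum>w\<in>V. (corr g v w)\<^sup>2) \<le> (\<Sum>w\<in>V. \<Sum>x\<in>V. v (add x w) * (g x)\<^sup>2)"
  proof (rule sum_mono)
    fix w assume w: "w \<in> V"
    have nn: "v (add x w) \<ge> 0" if "x \<in> V" for x
      using v(1) add_closed that w by simp
    have "(corr g v w)\<^sup>2 = (\<Sum>x\<in>V. sqrt (v (add x w)) * (sqrt (v (add x w)) * g x))\<^sup>2"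
      unfolding corr_def mult.assoc[symmetric] using nn
      by (intro arg_cong[where f = "\<lambda>z. z\<^sup>2"] sum.cong refl) (simp add: mult.commute)
    also have "\<dots> \<le> (\<Sum>x\<in>V. (sqrt (v (add x w)))\<^sup>2) * (\<Sum>x\<in>V. (sqrt (v (add x w)) * g x)\<^sup>2)"
      by (rule Cauchy_Schwarz_ineq_sum)
    also have "\<dots> = (\<Sum>x\<in>V. v (add x w) * (g x)\<^sup>2)"
      using nn sum_add_left[OF w, of v] v(2) by (simp add: power_mult_distrib)
    finally show "(corr g v w)\<^sup>2 \<le> (\<Sum>x\<in>V. v (add x w) * (g x)\<^sup>2)" .
  qed
  also have "\<dots> = (\<Sum>x\<in>V. (g x)\<^sup>2)"
    by (subst sum.swap) (simp add: sum_add_right v(2) flip: sum_distrib_right)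
  finally show ?thesis .
qed

lemma drift_ge:
  assumes v: "\<And>x. x \<in> V \<Longrightarrow> v x \<ge> 0" "sum v V = 1"
  shows "drift u v \<ge> - energy u"
proof -
  let ?Du = "\<lambda>i x. u (s i x) - u x" and ?Dv = "\<lambda>i x w. v (add (s i x) w) - v (add x w)"
  have "drift u v = (\<Sum>i\<in>UNIV. \<Sum>x\<in>V. \<Sum>w\<in>V.
      (corr (relax (Some (i, x)) u) v w)\<^sup>2 - (corr u v w)\<^sup>2)"
    unfolding drift_def sum_bonds overlap_def sum_subtractf ..
  also have "\<dots> \<ge> (\<Sum>i\<in>UNIV. \<Sum>x\<in>V. \<Sum>w\<in>V. - (corr u v w * (?Du i x * ?Dv i x w)))"
  proof (intro sum_mono)
    fix i x w assume "x \<in> V" "w \<in> V"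
    \<comment> \<open>Only the cross term is kept; the remaining square is nonnegative and is
      dropped.\<close>
    have "(c - a * b / 2)\<^sup>2 - c\<^sup>2 = - (c * (a * b)) + (a * b / 2)\<^sup>2" for a b c :: real
      by (simp add: power2_eq_square field_simps)
    then show "- (corr u v w * (?Du i x * ?Dv i x w)) \<le>
        (corr (relax (Some (i, x)) u) v w)\<^sup>2 - (corr u v w)\<^sup>2"
      unfolding corr_relax_left[OF \<open>x \<in> V\<close> \<open>w \<in> V\<close>] by simp
  qed
  also have "(\<Sum>i\<in>UNIV. \<Sum>x\<in>V. \<Sum>w\<in>V. - (corr u v w * (?Du i x * ?Dv i x w))) =
      - (\<Sum>i\<in>UNIV. \<Sum>w\<in>V. corr u v w * (\<Sum>x\<in>V. ?Du i x * ?Dv i x w))"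
    unfolding sum_negf sum_distrib_left by (intro arg_cong[where f = uminus] sum.cong refl sum.swap)
  also have "\<dots> = - (\<Sum>i\<in>UNIV. \<Sum>w\<in>V. (corr (?Du i) v w)\<^sup>2)"
    by (simp add: sum_corr_by_parts)
  also have "\<dots> \<ge> - (\<Sum>i\<in>UNIV. \<Sum>x\<in>V. (?Du i x)\<^sup>2)"
    unfolding neg_le_iff_le by (intro sum_mono sum_corr_square_le v)
  also have "(\<Sum>i\<in>UNIV. \<Sum>x\<in>V. (?Du i x)\<^sup>2) = energy u"
    unfolding energy_def by (rule sum.swap)
  finally show ?thesis .
qed

section \<open>Dissipation of the square norm and point masses\<close>

lemma sum_square_relax:
  assumes "x \<in> V"
  shows "(\<Sum>y\<in>V. (relax (Some (i, x)) u y)\<^sup>2) = (\<Sum>y\<in>V. (u y)\<^sup>2) - (u (s i x) - u x)\<^sup>2 / 2"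
proof -
  let ?r = "relax (Some (i, x)) u"
  \<comment> \<open>Testing against the averaged function itself kills the correction, since its two
    end values coincide: averaging is an orthogonal projection.\<close>
  have "(\<Sum>y\<in>V. ?r y * ?r y) = (\<Sum>y\<in>V. ?r y * u y)"
    unfolding inner_relax[OF assms, of i u ?r] by (simp add: mult.commute)
  then show ?thesis
    unfolding inner_relax[OF assms, of i u u] by (simp add: power2_eq_square)
qed

definition point_mass :: "'a \<Rightarrow> 'a \<Rightarrow> real" where
  "point_mass p x = (if x = p then 1 else 0)"

text \<open>For each lag exactly one site is carried to \<open>p\<close>, so the correlation is a
  single value of \<open>u\<close>; as the lag varies, every site is selected once.\<close>

lemma overlap_point_mass:
  assumes "p \<in> V"
  shows "overlap u (point_mass p) = (\<Sum>x\<in>V. (u x)\<^sup>2)"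
proof -
  have "(corr u (point_mass p) w)\<^sup>2 = (\<Sum>x\<in>V. (u x)\<^sup>2 * point_mass p (add x w))" if w: "w \<in> V" for w
  proof -
    obtain y where y: "y \<in> V" "add y w = p"
      using bij_add_left[OF w] assms by (metis (no_types, lifting) bij_betw_iff_bijections)
    have iff: "add x w = p \<longleftrightarrow> x = y" if "x \<in> V" for x
      using bij_add_left[OF w] y that by (auto simp: bij_betw_def dest: inj_onD)
    have sum_pm: "(\<Sum>x\<in>V. f x * point_mass p (add x w)) = f y" for f :: "'a \<Rightarrow> real"
    proof -
      have "(\<Sum>x\<in>V. f x * point_mass p (add x w)) = (\<Sum>x\<in>V. if x = y then f x else 0)"
        using iff by (intro sum.cong) (auto simp: point_mass_def)
      then show ?thesis
        using y by (simp add: finite_V)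
    qed
    show ?thesis
      unfolding corr_def sum_pm ..
  qed
  then have "overlap u (point_mass p) = (\<Sum>w\<in>V. \<Sum>x\<in>V. (u x)\<^sup>2 * point_mass p (add x w))"
    unfolding overlap_def by simp
  also have "\<dots> = (\<Sum>x\<in>V. (u x)\<^sup>2)"
    using assms sum_add_right[where f = "point_mass p"]
    by (subst sum.swap) (simp add: finite_V point_mass_def[abs_def] flip: sum_distrib_left)
  finally show ?thesis .
qed

text \<open>One averaging costs half the squared difference across its bond. This 1/2 against the 1
  in \<open>drift_ge\<close> is the origin of the factor 2.\<close>

lemma drift_point_mass:
  assumes "p \<in> V"
  shows "drift u (point_mass p) = - energy u / 2"
proof -
  have "drift u (point_mass p) = (\<Sum>b\<in>bonds. case b of (i, x) \<Rightarrow> - (u (s i x) - u x)\<^sup>2 / 2)"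
    unfolding drift_def overlap_point_mass[OF assms]
    by (intro sum.cong) (auto simp: bonds_def sum_square_relax simp del: relax.simps)
  also have "\<dots> = - energy u / 2"
    unfolding energy_bonds by (simp add: sum_negf sum_divide_distrib case_prod_unfold)
  finally show ?thesis .
qed

section \<open>Conservation and bounds along a word\<close>

lemma relax_nonneg:
  "a \<in> letters \<Longrightarrow> (\<And>x. x \<in> V \<Longrightarrow> v x \<ge> 0) \<Longrightarrow> x \<in> V \<Longrightarrow> relax a v x \<ge> 0"
  by (auto simp: letters_def bonds_def shift_closed)

lemma sum_relax: "a \<in> letters \<Longrightarrow> sum (relax a v) V = sum v V"
  using inner_relax[of _ _ v "\<lambda>_. 1"]
  by (auto simp: letters_def bonds_def simp del: relax.simps(2))

lemma run_simps [simp]: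
  "run [] u = u" "run (a # as) u = run as (relax a u)" "run (as @ [a]) u = relax a (run as u)"
  by (simp_all add: run_def)

lemma run_prob:
  assumes "set as \<subseteq> letters" "\<And>x. x \<in> V \<Longrightarrow> v x \<ge> 0"
  shows "(\<forall>x\<in>V. run as v x \<ge> 0) \<and> sum (run as v) V = sum v V"
  using assms(1)
  by (induction as rule: rev_induct) (auto simp: assms(2) relax_nonneg sum_relax)

lemma sum_square_run_le:
  assumes "set as \<subseteq> letters"
  shows "(\<Sum>x\<in>V. (run as u x)\<^sup>2) \<le> (\<Sum>x\<in>V. (u x)\<^sup>2)"
  using assms
proof (induction as rule: rev_induct)
  case (snoc a as)
  have "(\<Sum>x\<in>V. (relax a v x)\<^sup>2) \<le> (\<Sum>x\<in>V. (v x)\<^sup>2)" if "a \<in> letters" for v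
    using that by (auto simp: letters_def bonds_def sum_square_relax simp del: relax.simps(2))
  from this[of "run as u"] snoc show ?case
    by simp
qed simp

text \<open>A crude bound which, combined with \<open>sum_square_run_le\<close>, controls the energy
  uniformly over all words, as the final limit requires.\<close>

lemma energy_le:
  fixes u :: "'a \<Rightarrow> real"
  shows "energy u \<le> 4 * CARD('i) * (\<Sum>x\<in>V. (u x)\<^sup>2)"
proof -
  have "energy u \<le> (\<Sum>x\<in>V. \<Sum>i\<in>(UNIV::'i set). 2 * (u (s i x))\<^sup>2 + 2 * (u x)\<^sup>2)"
    unfolding energy_def
  proof (intro sum_mono)
    fix x i
    have "2 * (u (s i x))\<^sup>2 + 2 * (u x)\<^sup>2 - (u (s i x) - u x)\<^sup>2 = (u (s i x) + u x)\<^sup>2"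
      by (simp add: power2_eq_square algebra_simps)
    then show "(u (s i x) - u x)\<^sup>2 \<le> 2 * (u (s i x))\<^sup>2 + 2 * (u x)\<^sup>2"
      by (smt (verit) zero_le_power2)
  qed
  also have "\<dots> = (\<Sum>i\<in>(UNIV::'i set). 2 * (\<Sum>x\<in>V. (u (s i x))\<^sup>2) + 2 * (\<Sum>x\<in>V. (u x)\<^sup>2))"
    by (subst sum.swap) (simp add: sum.distrib sum_distrib_left)
  also have "\<dots> = 4 * CARD('i) * (\<Sum>x\<in>V. (u x)\<^sup>2)"
    by (simp add: sum_shift[where f = "\<lambda>x. (u x)\<^sup>2"])
  finally show ?thesis .
qed

section \<open>Words with product weights\<close>

definition words :: "nat \<Rightarrow> ('i \<times> 'a) option list set" where
  "words m = {as. set as \<subseteq> letters \<and> length as = m}"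

lemma finite_words: "finite (words m)"
  unfolding words_def by (rule finite_lists_length_eq[OF finite_letters])

lemma sum_words_0: "sum f (words 0) = f []"
  by (simp add: words_def conj_commute cong: conj_cong)

lemma sum_words_Cons: "sum f (words (Suc m)) = (\<Sum>a\<in>letters. \<Sum>as\<in>words m. f (a # as))"
  unfolding sum.cartesian_product
  by (rule sum.reindex_bij_witness[where i = "\<lambda>(a, as). a # as" and j = "\<lambda>as. (hd as, tl as)"])
    (auto simp: words_def length_Suc_conv)

lemma sum_words_snoc: "sum f (words (Suc m)) = (\<Sum>as\<in>words m. \<Sum>a\<in>letters. f (as @ [a]))"
  unfolding sum.cartesian_product
  by (rule sum.reindex_bij_witness[where i = "\<lambda>(as, a). as @ [a]"
        and j = "\<lambda>as. (butlast as, last as)"])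
    (auto simp: words_def length_Suc_conv_rev)

text \<open>\<open>p\<close> is the weight of a silent interval, \<open>q\<close> that of a ring on
  one given bond. In the application the total per letter is below 1, because intervals with several
  rings are left out.\<close>

definition weight :: "real \<Rightarrow> real \<Rightarrow> ('i \<times> 'a) option list \<Rightarrow> real" where
  "weight p q as = prod_list (map (\<lambda>a. if a = None then p else q) as)"

lemma sum_weight:
  fixes p q :: real
  shows "(\<Sum>as\<in>words m. weight p q as) = (p + card bonds * q) ^ m"
proof (induction m)
  case (Suc m)
  have "(\<Sum>as\<in>words (Suc m). weight p q as) =
      (\<Sum>a\<in>letters. (if a = None then p else q) * (\<Sum>as\<in>words m. weight p q as))"
    by (simp add: sum_words_Cons weight_def sum_distrib_left)
  then show ?case
    by (simp add: Suc sum_letters algebra_simps)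
qed (simp add: sum_words_0 weight_def)

text \<open>The last averaging applied to \<open>u\<close> becomes the first one applied to
  \<open>v\<close>. Duality thus reverses words, and product weights do not see the order.\<close>

lemma sum_weight_drift:
  "(\<Sum>as\<in>words m. weight p q as * drift (run as u) v) =
    (\<Sum>as\<in>words m. weight p q as * drift u (run as v))"
proof (induction m arbitrary: v)
  case (Suc m)
  let ?w = "\<lambda>a. if a = None then p else q"
  \<comment> \<open>All bonds share the weight \<open>q\<close>, so \<open>sum_drift_relax\<close>
    applies to the bond part of the sum.\<close>
  have one: "(\<Sum>a\<in>letters. ?w a * drift (relax a u) v) = (\<Sum>a\<in>letters. ?w a * drift u (relax a v))"
    for u v
    by (simp add: sum_letters sum_drift_relax flip: sum_distrib_left del: relax.simps(2))
  have "(\<Sum>as\<in>words (Suc m). weight p q as * drift (run as u) v) =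
      (\<Sum>as\<in>words m. weight p q as * (\<Sum>a\<in>letters. ?w a * drift (relax a (run as u)) v))"
    by (simp add: sum_words_snoc weight_def sum_distrib_left mult_ac)
  also have "\<dots> = (\<Sum>a\<in>letters. ?w a * (\<Sum>as\<in>words m. weight p q as * drift (run as u) (relax a v)))"
    unfolding one sum_distrib_left by (subst sum.swap) (simp add: mult_ac)
  also have "\<dots> = (\<Sum>as\<in>words (Suc m). weight p q as * drift u (run as v))"
    unfolding Suc sum_words_Cons by (simp add: weight_def sum_distrib_left mult_ac)
  finally show ?case .
qed (simp add: sum_words_0)

text \<open>Duality moves the word onto a point mass, which stays a probability vector, so
  \<open>drift_ge\<close> compares each term with the energy of the initial
  \<open>u\<close>.\<close>

lemma sum_weight_energy_le:
  fixes p q :: real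
  assumes "p \<ge> 0" "q \<ge> 0" "p + card bonds * q \<le> 1"
  shows "(\<Sum>as\<in>words m. weight p q as * energy (run as u)) \<le> 2 * energy u"
proof -
  obtain z where z: "z \<in> V"
    using V_nonempty by blast
  have wnn: "weight p q as \<ge> 0" for as
    unfolding weight_def using assms by (intro prod_list_nonneg) auto
  have "(\<Sum>as\<in>words m. weight p q as * energy (run as u)) =
      - 2 * (\<Sum>as\<in>words m. weight p q as * drift (run as u) (point_mass z))"
    by (simp add: drift_point_mass[OF z] sum_distrib_left)
  also have "\<dots> = 2 * (\<Sum>as\<in>words m. weight p q as * (- drift u (run as (point_mass z))))"
    unfolding sum_weight_drift by (simp add: sum_negf)
  also have "(\<Sum>as\<in>words m. weight p q as * (- drift u (run as (point_mass z)))) \<le>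
      (\<Sum>as\<in>words m. weight p q as * energy u)"
  proof (intro sum_mono mult_left_mono wnn)
    fix as assume "as \<in> words m"
    then have "(\<forall>x\<in>V. run as (point_mass z) x \<ge> 0) \<and>
        sum (run as (point_mass z)) V = sum (point_mass z) V"
      by (intro run_prob) (auto simp: words_def point_mass_def)
    moreover have "sum (point_mass z) V = 1"
      using z by (simp add: point_mass_def finite_V)
    ultimately have "drift u (run as (point_mass z)) \<ge> - energy u"
      by (intro drift_ge) auto
    then show "- drift u (run as (point_mass z)) \<le> energy u"
      by simp
  qed
  also have "\<dots> = (p + card bonds * q) ^ m * energy u"
    by (simp add: sum_weight flip: sum_distrib_right)
  also have "\<dots> \<le> energy u"
    using assms energy_nonneg by (intro mult_left_le_one_le power_le_one) auto
  finally show ?thesis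
    by simp
qed

lemma relax_cong:
  "a \<in> letters \<Longrightarrow> (\<And>x. x \<in> V \<Longrightarrow> u x = v x) \<Longrightarrow> y \<in> V \<Longrightarrow> relax a u y = relax a v y"
  by (auto simp: letters_def bonds_def shift_closed)

lemma energy_cong: "(\<And>x. x \<in> V \<Longrightarrow> u x = v x) \<Longrightarrow> energy u = energy v"
  by (simp add: energy_def shift_closed)

text \<open>A count of mean \<open>L\<close> is 0 with probability \<open>exp (- L)\<close> and 1
  with probability \<open>L * exp (- L)\<close>. Hence each interval contributes a factor that
  depends only on whether its letter is \<open>None\<close>.\<close>

lemma prod_poisson_weight:
  assumes as: "as \<in> words m" and L: "0 < L"
  shows "(\<Prod>b\<in>bonds. \<Prod>k<m. pmf (poisson_pmf L) (if as ! k = Some b then 1 else 0)) =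
    weight (exp (- L) ^ card bonds) (L * exp (- L) ^ card bonds) as"
proof -
  have "(\<Prod>b\<in>bonds. pmf (poisson_pmf L) (if a = Some b then 1 else 0)) =
      (if a = None then exp (- L) ^ card bonds else L * exp (- L) ^ card bonds)"
    if "a \<in> letters" for a
  proof -
    have "(\<Prod>b\<in>bonds. pmf (poisson_pmf L) (if a = Some b then 1 else 0)) =
        (\<Prod>b\<in>bonds. (if a = Some b then L else 1) * exp (- L))"
      using L by (intro prod.cong) auto
    also have "\<dots> = (\<Prod>b\<in>bonds. if a = Some b then L else 1) * exp (- L) ^ card bonds"
      by (simp add: prod.distrib)
    also have "(\<Prod>b\<in>bonds. if a = Some b then L else 1) = (if a = None then 1 else L)"
      using that by (auto simp: letters_def finite_bonds)
    finally show ?thesis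
      by simp
  qed
  moreover have "as ! k \<in> letters" if "k < m" for k
    using as that nth_mem by (fastforce simp: words_def)
  ultimately show ?thesis
    using as by (subst prod.swap)
      (simp add: weight_def words_def prod.list_conv_set_nth atLeast0LessThan)
qed

end

section \<open>The discrete torus\<close>

definition torus_add :: "real ^ 'd::finite \<Rightarrow> real ^ 'd \<Rightarrow> real ^ 'd" where
  "torus_add x w = (\<chi> j. frac (x $ j + w $ j))"

lemma torus_add_assoc: "torus_add (torus_add x y) z = torus_add x (torus_add y z)"
  by (simp add: torus_add_def vec_eq_iff add.assoc)

lemma torus_add_commute: "torus_add x y = torus_add y x"
  by (simp add: torus_add_def add.commute)

lemma shift_eq_torus_add: "shift \<epsilon> i x = torus_add x (\<epsilon> *\<^sub>R axis i 1)"
  by (simp add: shift_def torus_add_def)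

text \<open>Reduction modulo 1 subtracts an integer, which is a multiple of the mesh because
  \<open>1 / \<epsilon>\<close> is a natural number.\<close>

lemma torus_add_closed:
  assumes "0 < \<epsilon>" "1 / \<epsilon> \<in> \<nat>" "x \<in> torus \<epsilon>" "w \<in> torus \<epsilon>"
  shows "torus_add x w \<in> torus \<epsilon>"
proof -
  obtain n :: nat where "1 / \<epsilon> = real n"
    using assms(2) by (auto elim: Nats_cases)
  then have n: "\<epsilon> * real n = 1"
    using assms(1) by (simp add: field_simps)
  have "\<exists>k::int. frac (x $ j + w $ j) = \<epsilon> * of_int k" for j
  proof -
    obtain k l :: int where "x $ j = \<epsilon> * of_int k" "w $ j = \<epsilon> * of_int l"
      using assms(3,4) unfolding torus_def by blast
    then have "frac (x $ j + w $ j) = \<epsilon> * of_int k + \<epsilon> * of_int l - (\<epsilon> * real n) * of_int \<lfloor>x $ j + w $ j\<rfloor>"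
      unfolding n by (simp add: frac_def)
    also have "\<dots> = \<epsilon> * of_int (k + l - int n * \<lfloor>x $ j + w $ j\<rfloor>)"
      by (simp add: algebra_simps)
    finally show ?thesis ..
  qed
  then show ?thesis
    by (simp add: torus_def torus_add_def frac_lt_1)
qed

text \<open>Two representatives with the same translate differ by an integer of modulus less than
  1.\<close>

lemma inj_on_torus_add: "inj_on (\<lambda>x. torus_add x w) (torus \<epsilon>)"
proof (rule inj_onI)
  fix x y :: "real ^ 'a" assume xy: "x \<in> torus \<epsilon>" "y \<in> torus \<epsilon>" "torus_add x w = torus_add y w"
  have "x $ j = y $ j" for j
  proof -
    have "frac (x $ j + w $ j) = frac (y $ j + w $ j)"
      using xy(3) by (simp add: torus_add_def vec_eq_iff)
    then have "x $ j - y $ j = of_int (\<lfloor>x $ j + w $ j\<rfloor> - \<lfloor>y $ j + w $ j\<rfloor>)"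
      by (simp add: frac_def)
    then have "x $ j - y $ j \<in> \<int>"
      by (metis Ints_of_int)
    moreover have "\<bar>x $ j - y $ j\<bar> < 1"
      using xy(1,2) unfolding torus_def by (smt (verit) mem_Collect_eq)
    ultimately show ?thesis
      using Ints_nonzero_abs_less1 by fastforce
  qed
  then show "x = y"
    by (simp add: vec_eq_iff)
qed

lemma finite_torus:
  assumes "0 < \<epsilon>"
  shows "finite (torus \<epsilon> :: (real ^ 'd::finite) set)"
proof -
  let ?F = "(\<lambda>k::int. \<epsilon> * of_int k) ` {0..\<lfloor>1 / \<epsilon>\<rfloor>}"
  have "x $ j \<in> ?F" if x: "x \<in> torus \<epsilon>" for x :: "real ^ 'd" and j
  proof -
    obtain k :: int where k: "x $ j = \<epsilon> * of_int k"
      using x unfolding torus_def by blast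
    have "0 \<le> \<epsilon> * of_int k" "\<epsilon> * of_int k < 1"
      using x unfolding k[symmetric] torus_def by auto
    then have "0 \<le> k" "k \<le> \<lfloor>1 / \<epsilon>\<rfloor>"
      using assms by (auto simp: zero_le_mult_iff le_floor_iff field_simps)
    then show ?thesis
      using k by auto
  qed
  then have "torus \<epsilon> \<subseteq> (\<lambda>f. \<chi> j. f j) ` {f :: 'd \<Rightarrow> real. \<forall>j. f j \<in> ?F}"
    by (auto intro!: image_eqI[where x = "\<lambda>j. x $ j" for x :: "real ^ 'd"] simp: vec_eq_iff)
  moreover have "finite {f :: 'd \<Rightarrow> real. \<forall>j. f j \<in> ?F}"
    using finite_set_of_finite_funs[of "UNIV :: 'd set" ?F] by simp
  ultimately show ?thesis
    by (meson finite_imageI finite_subset)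
qed

lemma torus_shifts_torus:
  assumes "0 < \<epsilon>" "\<epsilon> < 1" "1 / \<epsilon> \<in> \<nat>"
  shows "torus_shifts (torus \<epsilon> :: (real ^ 'd::finite) set) (shift \<epsilon>) torus_add"
proof -
  let ?V = "torus \<epsilon> :: (real ^ 'd) set"
  have e: "\<epsilon> *\<^sub>R axis i 1 \<in> ?V" for i
    using assms by (auto simp: torus_def axis_def intro: exI[of _ 0] exI[of _ 1])
  \<comment> \<open>An injective self-map of a finite set is onto.\<close>
  have bij: "bij_betw (\<lambda>x. torus_add x w) ?V ?V" if "w \<in> ?V" for w
    unfolding bij_betw_def using inj_on_torus_add torus_add_closed[OF assms(1,3) _ that]
    by (intro conjI endo_inj_surj finite_torus[OF assms(1)]) auto
  \<comment> \<open>A fixed point would make the mesh an integer strictly between 0 and 1.\<close>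
  have neq: "shift \<epsilon> i x \<noteq> x" if "x \<in> ?V" for i x
  proof
    assume "shift \<epsilon> i x = x"
    then have "frac (x $ i + \<epsilon>) = x $ i"
      by (auto simp: shift_def vec_eq_iff dest: spec[of _ i])
    then have "\<epsilon> = of_int \<lfloor>x $ i + \<epsilon>\<rfloor>"
      by (simp add: frac_def)
    then show False
      using assms by (metis of_int_0_less_iff of_int_less_1_iff zless_imp_add1_zle add_0 linorder_not_le)
  qed
  show ?thesis
  proof
    show "bij_betw (torus_add x) ?V ?V" if "x \<in> ?V" for x
      using bij[OF that] unfolding torus_add_commute[of _ x] .
    show "bij_betw (shift \<epsilon> i) ?V ?V" for i
      using bij[OF e] by (simp add: shift_eq_torus_add[abs_def])
    show "?V \<noteq> {}"
      using e by blast
    show "torus_add (shift \<epsilon> i x) w = shift \<epsilon> i (torus_add x w)" for i and x w :: "real ^ 'd"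
      unfolding shift_eq_torus_add by (metis torus_add_assoc torus_add_commute)
    show "torus_add x (shift \<epsilon> i w) = shift \<epsilon> i (torus_add x w)" for i and x w :: "real ^ 'd"
      unfolding shift_eq_torus_add by (simp add: torus_add_assoc)
  qed (use finite_torus[OF assms(1)] bij neq in auto)
qed

section \<open>Paths and clocks\<close>

lemma not_arrival:
  assumes "mono_on {0..} f" "0 \<le> a" "f b = f a" "r \<in> {a<..b}"
  shows "\<not> arrival f r"
proof
  assume "arrival f r"
  then have "f a < f r"
    using assms by (auto simp: arrival_def)
  moreover have "f r \<le> f b"
    using assms by (intro mono_onD[OF assms(1)]) auto
  ultimately show False
    using assms(3) by simp
qed

text \<open>The arrival is the infimum of the times at which the final value is attained.
  Right-continuity puts it among these times, and an increment of 1 leaves no intermediate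
  value.\<close>

lemma single_arrival:
  assumes mono: "mono_on {0..} f" and rc: "\<And>t. t \<ge> 0 \<Longrightarrow> continuous (at_right t) f"
    and ab: "0 \<le> a" "a < b" "f b = Suc (f a)"
  obtains r where "r \<in> {a<..b}" "arrival f r" "\<And>q. a \<le> q \<Longrightarrow> q < r \<Longrightarrow> f q = f a" "f r = f b"
proof -
  define S where "S = {q. a \<le> q \<and> q \<le> b \<and> f q = f b}"
  define r where "r = Inf S"
  have b: "b \<in> S" and bdd: "bdd_below S"
    using ab by (auto simp: S_def intro: bdd_belowI[of _ a])
  have ra: "a \<le> r"
    unfolding r_def using b by (intro cInf_greatest) (auto simp: S_def)
  have rb: "r \<le> b"
    unfolding r_def using b bdd by (rule cInf_lower)
  have fr: "f r = f b"
  proof (rule ccontr)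
    assume ne: "f r \<noteq> f b"
    have "(f \<longlongrightarrow> f r) (at_right r)"
      using rc[of r] ra ab by (simp add: continuous_within)
    \<comment> \<open>The values are discrete, so a right limit is attained on a whole
      interval.\<close>
    then have "eventually (\<lambda>q. f q = f r) (at_right r)"
      by (simp add: tendsto_discrete)
    then obtain d where d: "d > r" "\<And>q. r < q \<Longrightarrow> q < d \<Longrightarrow> f q = f r"
      unfolding eventually_at_right_field by blast
    obtain q where q: "q \<in> S" "q < d"
      using d(1) b cInf_lessD[of S d] unfolding r_def by blast
    have "r \<le> q"
      unfolding r_def using q(1) bdd by (rule cInf_lower)
    then have "f q = f r"
      using d(2)[OF _ q(2)] by (cases "r = q") auto
    with q(1) ne show False
      by (simp add: S_def)
  qed
  have "r \<noteq> a"
    using fr ab by auto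
  have before: "f q = f a" if "a \<le> q" "q < r" for q
  proof -
    have "q \<notin> S"
      using that bdd unfolding r_def by (meson cInf_lower linorder_not_le)
    moreover have "f a \<le> f q" "f q \<le> f b"
      using that ab(1) rb by (intro mono_onD[OF mono]; simp)+
    ultimately show ?thesis
      using that rb ab(3) by (auto simp: S_def)
  qed
  have "f q < f r" if "0 \<le> q" "q < r" for q
  proof -
    \<comment> \<open>An arrival compares with all earlier times, including those before
      \<open>a\<close>.\<close>
    have "f q \<le> f (max q a)"
      using that ab by (intro mono_onD[OF mono]) auto
    also have "\<dots> = f a"
      using that ra \<open>r \<noteq> a\<close> by (intro before) auto
    finally show ?thesis
      using fr ab by simp
  qed
  then have "arrival f r"
    using ra \<open>r \<noteq> a\<close> ab by (auto simp: arrival_def)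
  show ?thesis
  proof (rule that)
    show "r \<in> {a<..b}"
      using ra rb \<open>r \<noteq> a\<close> by simp
  qed fact+
qed

text \<open>If the single ring occurs at \<open>r\<close>, the path is frozen from \<open>a\<close>
  up to \<open>r\<close>, so its left limits there are the values at \<open>a\<close>; it is updated
  once and frozen again up to \<open>b\<close>.\<close>

lemma averaging_path_step:
  fixes n :: "'d::finite \<Rightarrow> real ^ 'd \<Rightarrow> real \<Rightarrow> nat"
  assumes \<epsilon>: "0 < \<epsilon>" "\<epsilon> < 1" "1 / \<epsilon> \<in> \<nat>"
    and path: "averaging_path \<epsilon> n u\<^sub>0 u"
    and mono: "\<And>i x. x \<in> torus \<epsilon> \<Longrightarrow> mono_on {0..} (n i x)"
    and rc: "\<And>i x t. x \<in> torus \<epsilon> \<Longrightarrow> 0 \<le> t \<Longrightarrow> continuous (at_right t) (n i x)"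
    and ab: "0 \<le> a" "a < b"
    and l: "l \<in> torus_shifts.letters (torus \<epsilon>)"
    and incr: "\<And>i x. x \<in> torus \<epsilon> \<Longrightarrow> n i x b - n i x a = (if l = Some (i, x) then 1 else 0)"
    and y: "y \<in> torus \<epsilon>"
  shows "u b y = torus_shifts.relax (shift \<epsilon>) l (u a) y"
proof -
  interpret T: torus_shifts "torus \<epsilon> :: (real ^ 'd) set" "shift \<epsilon>" torus_add
    by (rule torus_shifts_torus[OF \<epsilon>])
  \<comment> \<open>Monotonicity rules out truncation in the differences of \<open>incr\<close>, so
    a zero difference means equality.\<close>
  have le: "n i x a \<le> n i x b" if "x \<in> torus \<epsilon>" for i x
    using ab by (intro mono_onD[OF mono[OF that]]) auto
  have const: "u q z = u p z"
    if "0 \<le> p" "p < q" "z \<in> torus \<epsilon>" 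
      "\<And>i x r. x \<in> torus \<epsilon> \<Longrightarrow> r \<in> {p<..q} \<Longrightarrow> \<not> arrival (n i x) r" for p q z
    using path that unfolding averaging_path_def by blast
  have quiet: "\<not> arrival (n i x) r" if "x \<in> torus \<epsilon>" "l \<noteq> Some (i, x)" "r \<in> {a<..b}" for i x r
    using that ab le[of x i] incr[of x i] by (intro not_arrival[OF mono, of x a i b r]) auto
  show ?thesis
  proof (cases l)
    case None
    then show ?thesis
      using const[of a b y] quiet ab y by simp
  next
    case (Some e)
    then obtain i x where e: "l = Some (i, x)" and x: "x \<in> torus \<epsilon>"
      using l by (auto simp: T.letters_def T.bonds_def)
    have "n i x b = Suc (n i x a)"
      using incr[OF x, of i] le[OF x, of i] e by auto
    then obtain r where r: "r \<in> {a<..b}" "arrival (n i x) r" "n i x r = n i x b"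
        "\<And>q. a \<le> q \<Longrightarrow> q < r \<Longrightarrow> n i x q = n i x a"
      using single_arrival[of "n i x" a b, OF mono[OF x] rc[OF x]] ab by blast
    have pre: "u q z = u a z" if "a < q" "q < r" "z \<in> torus \<epsilon>" for q z
    proof (rule const)
      fix j r' and x' :: "real ^ 'd" assume "x' \<in> torus \<epsilon>" "r' \<in> {a<..q}"
      moreover have "n i x q = n i x a"
        using that by (intro r(4)) auto
      ultimately show "\<not> arrival (n j x') r'"
        using quiet[of x' j r'] not_arrival[OF mono[OF x, of i], of a q r'] r(1) that(2) ab(1) e
        by (cases "j = i \<and> x' = x") auto
    qed (use that ab in auto)
    have lim: "left_lim (\<lambda>q. u q z) r = u a z" if "z \<in> torus \<epsilon>" for z
      unfolding left_lim_def using r(1) pre that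
      by (intro tendsto_Lim tendsto_eventually eventually_at_leftI[of a]) auto
    have "u r y = T.relax l (u a) y"
      using path x y r(2) lim[OF y] lim[OF x] lim[OF T.shift_closed[OF x]]
      unfolding averaging_path_def e by simp
    moreover have "u b y = u r y"
    proof (cases "r = b")
      case False
      show ?thesis
      proof (rule const)
        fix j r' and x' :: "real ^ 'd" assume "x' \<in> torus \<epsilon>" "r' \<in> {r<..b}"
        then show "\<not> arrival (n j x') r'"
          using quiet[of x' j r'] not_arrival[OF mono[OF x, of i], of r b r'] r(1,3) ab(1) e
          by (cases "j = i \<and> x' = x") auto
      qed (use r ab y False in auto)
    qed simp
    ultimately show ?thesis
      by simp
  qed
qed

text \<open>Letter \<open>k\<close> records the rings between \<open>k * h\<close> and
  \<open>Suc k * h\<close>; induction from the end of the word follows time.\<close>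

lemma averaging_path_run:
  fixes n :: "'d::finite \<Rightarrow> real ^ 'd \<Rightarrow> real \<Rightarrow> nat"
  assumes \<epsilon>: "0 < \<epsilon>" "\<epsilon> < 1" "1 / \<epsilon> \<in> \<nat>"
    and path: "averaging_path \<epsilon> n u\<^sub>0 u"
    and mono: "\<And>i x. x \<in> torus \<epsilon> \<Longrightarrow> mono_on {0..} (n i x)"
    and rc: "\<And>i x t. x \<in> torus \<epsilon> \<Longrightarrow> 0 \<le> t \<Longrightarrow> continuous (at_right t) (n i x)"
    and h: "0 < h"
    and as: "set as \<subseteq> torus_shifts.letters (torus \<epsilon>)"
    and incr: "\<And>i x k. x \<in> torus \<epsilon> \<Longrightarrow> k < length as \<Longrightarrow>
      n i x (real (Suc k) * h) - n i x (real k * h) = (if as ! k = Some (i, x) then 1 else 0)"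
    and y: "y \<in> torus \<epsilon>"
  shows "u (real (length as) * h) y = torus_shifts.run (shift \<epsilon>) as u\<^sub>0 y"
  using as incr y
proof (induction as arbitrary: y rule: rev_induct)
  interpret T: torus_shifts "torus \<epsilon> :: (real ^ 'd) set" "shift \<epsilon>" torus_add
    by (rule torus_shifts_torus[OF \<epsilon>])
  {
    case Nil
    then show ?case
      using path by (simp add: averaging_path_def)
  next
    case (snoc a as)
    have "u (real (length as) * h) x = T.run as u\<^sub>0 x" if "x \<in> torus \<epsilon>" for x
    proof (rule snoc.IH[OF _ _ that])
      fix i k and x :: "real ^ 'd" assume "x \<in> torus \<epsilon>" "k < length as"
      then show "n i x (real (Suc k) * h) - n i x (real k * h) =
          (if as ! k = Some (i, x) then 1 else 0)"
        using snoc.prems(2)[of x k i] by (simp add: nth_append)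
    qed (use snoc.prems in auto)
    moreover have "u (real (Suc (length as)) * h) y = T.relax a (u (real (length as) * h)) y"
    proof (rule averaging_path_step[OF \<epsilon> path mono rc])
      show "n i x (real (Suc (length as)) * h) - n i x (real (length as) * h) =
          (if a = Some (i, x) then 1 else 0)" if "x \<in> torus \<epsilon>"
        for i and x :: "real ^ 'd"
        using snoc.prems(2)[OF that, of "length as" i] by simp
    qed (use snoc.prems h in auto)
    ultimately show ?case
      using snoc.prems by (simp add: T.relax_cong[of a "u (real (length as) * h)" "T.run as u\<^sub>0"])
  }
qed

section \<open>Joint law of the clock increments\<close>

lemma iid_poisson_processes_increments:
  fixes N :: "'i \<Rightarrow> real \<Rightarrow> 'w \<Rightarrow> nat" and a :: "'i \<Rightarrow> nat \<Rightarrow> nat"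
  assumes "prob_space M" and iid: "iid_poisson_processes M r I N"
    and I: "finite I" "I \<noteq> {}" and h: "0 < h" and m: "0 < m"
  shows "{\<omega>\<in>space M. \<forall>p\<in>I. \<forall>k<m. N p (real (Suc k) * h) \<omega> - N p (real k * h) \<omega> = a p k} \<in> sets M"
    (is "?E \<in> _")
    and "measure M {\<omega>\<in>space M. \<forall>p\<in>I. \<forall>k<m. N p (real (Suc k) * h) \<omega> - N p (real k * h) \<omega> = a p k} =
      (\<Prod>p\<in>I. \<Prod>k<m. pmf (poisson_pmf (r * h)) (a p k))"
proof -
  interpret prob_space M by fact
  define inc where "inc p k \<omega> = N p (real (Suc k) * h) \<omega> - N p (real k * h) \<omega>" for p k \<omega>
  define P where "P = Pi\<^sub>M {0::real..} (\<lambda>_. count_space (UNIV :: nat set))"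
  \<comment> \<open>Independence of the clocks lives on path space, so each clock's increment
    pattern is phrased as a set of paths; the increments of one clock are separated
    afterwards.\<close>
  define A where "A p = {f \<in> space P. \<forall>k<m. f (real (Suc k) * h) - f (real k * h) = a p k}" for p
  define X where "X p = (\<lambda>\<omega>. \<lambda>t\<in>{0..}. N p t \<omega>)" for p
  have pp: "poisson_process M r (N p)" if "p \<in> I" for p
    using iid that by (auto simp: iid_poisson_processes_def)
  have indep: "indep_vars (\<lambda>_. P) X I"
    using iid by (simp add: iid_poisson_processes_def P_def X_def[abs_def])
  have ev: "(\<lambda>f. f t) \<in> measurable P (count_space UNIV)" if "0 \<le> t" for t
    unfolding P_def using that by (intro measurable_component_singleton) auto
  have A: "A p \<in> sets P" for p
  proof -
    have "{f \<in> space P. f (real (Suc k) * h) - f (real k * h) = a p k} \<in> sets P" for k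
    proof -
      \<comment> \<open>Splitting over the countably many pairs of values reduces measurability to
        single evaluations.\<close>
      have "{f \<in> space P. f (real (Suc k) * h) - f (real k * h) = a p k} =
          {f \<in> space P. \<exists>c d. c - d = a p k \<and> f (real (Suc k) * h) = c \<and> f (real k * h) = d}"
        by auto
      also have "\<dots> \<in> sets P"
        using h by (intro sets.sets_Collect_countable_Ex sets.sets_Collect_conj sets.sets_Collect_const)
          (intro measurable_sets_Collect[OF ev]; simp)+
      finally show ?thesis .
    qed
    then show ?thesis
      unfolding A_def by (intro sets.sets_Collect_countable_All sets.sets_Collect_imp) simp_all
  qed
  have pre: "X p -` A p \<inter> space M = {\<omega>\<in>space M. \<forall>k<m. inc p k \<omega> = a p k}" if "p \<in> I" for p
    using h by (auto simp: A_def X_def P_def inc_def space_PiM)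
  have E: "?E = (\<Inter>p\<in>I. X p -` A p \<inter> space M)"
    using I(2) pre by (auto simp: inc_def)
  have "X p -` A p \<inter> space M \<in> events" if "p \<in> I" for p
    using indep that A by (auto simp: indep_vars_def intro: measurable_sets)
  then show "?E \<in> events"
    unfolding E using I by (intro sets.finite_INT) auto
  have "prob {\<omega>\<in>space M. \<forall>k<m. inc p k \<omega> = a p k} = (\<Prod>k<m. pmf (poisson_pmf (r * h)) (a p k))"
    if p: "p \<in> I" for p
  proof -
    \<comment> \<open>The finite grid is continued to an infinite sequence, the form in which
      independence of increments is assumed.\<close>
    have "strict_mono (\<lambda>k. real k * h)"
      using h by (intro strict_monoI) simp
    then have ind: "indep_vars (\<lambda>_. count_space UNIV) (inc p) {..<m}"
      using pp[OF p] h unfolding poisson_process_def inc_def[abs_def]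
      by (auto dest!: conjunct2 elim!: allE[of _ "\<lambda>k. real k * h"])
    have "prob {\<omega>\<in>space M. \<forall>k<m. inc p k \<omega> = a p k} =
        prob (\<Inter>k<m. inc p k -` {a p k} \<inter> space M)"
      using m by (intro arg_cong[where f = prob]) auto
    also have "\<dots> = (\<Prod>k<m. prob (inc p k -` {a p k} \<inter> space M))"
      using m by (intro indep_varsD[OF ind]) auto
    also have "\<dots> = (\<Prod>k<m. pmf (poisson_pmf (r * h)) (a p k))"
    proof (rule prod.cong[OF refl])
      fix k assume "k \<in> {..<m}"
      have "distr M (count_space UNIV) (inc p k) =
          measure_pmf (poisson_pmf (r * (real (Suc k) * h - real k * h)))"
        using pp[OF p] h unfolding poisson_process_def inc_def[abs_def] by simp
      then have d: "distr M (count_space UNIV) (inc p k) = measure_pmf (poisson_pmf (r * h))"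
        by (simp add: algebra_simps)
      have "inc p k \<in> measurable M (count_space UNIV)"
        using ind \<open>k \<in> {..<m}\<close> by (auto simp: indep_vars_def)
      then have "prob (inc p k -` {a p k} \<inter> space M) =
          measure (distr M (count_space UNIV) (inc p k)) {a p k}"
        by (simp add: measure_distr)
      then show "prob (inc p k -` {a p k} \<inter> space M) = pmf (poisson_pmf (r * h)) (a p k)"
        unfolding d by (simp add: pmf.rep_eq)
    qed
    finally show ?thesis .
  qed
  then show "prob ?E = (\<Prod>p\<in>I. \<Prod>k<m. pmf (poisson_pmf (r * h)) (a p k))"
    unfolding E using I A by (subst indep_varsD_finite[OF indep]) (auto simp: pre)
qed

lemma H1_norm_square:
  fixes h :: "real ^ 'd::finite \<Rightarrow> real"
  assumes "0 < \<epsilon>" "\<epsilon> < 1" "1 / \<epsilon> \<in> \<nat>"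
  shows "(H1_norm \<epsilon> h)\<^sup>2 = \<epsilon> ^ CARD('d) / \<epsilon>\<^sup>2 * torus_shifts.energy (torus \<epsilon>) (shift \<epsilon>) h"
proof -
  interpret T: torus_shifts "torus \<epsilon> :: (real ^ 'd) set" "shift \<epsilon>" torus_add
    by (rule torus_shifts_torus[OF assms])
  have "(H1_norm \<epsilon> h)\<^sup>2 = \<epsilon> ^ CARD('d) * (\<Sum>x\<in>torus \<epsilon>. \<Sum>i\<in>UNIV. \<bar>grad \<epsilon> i h x\<bar>\<^sup>2)"
    unfolding H1_norm_def using assms(1)
    by (intro real_sqrt_pow2 mult_nonneg_nonneg sum_nonneg) auto
  also have "(\<Sum>x\<in>torus \<epsilon>. \<Sum>i\<in>UNIV. \<bar>grad \<epsilon> i h x\<bar>\<^sup>2) = T.energy h / \<epsilon>\<^sup>2"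
    by (simp add: T.energy_def grad_def power_divide sum_divide_distrib)
  finally show ?thesis
    by simp
qed

section \<open>The expected energy\<close>

theorem lemma2p3:
  fixes M :: "'w measure"
    and \<epsilon> t :: real
    and N :: "'d::finite \<Rightarrow> real ^ 'd \<Rightarrow> real \<Rightarrow> 'w \<Rightarrow> nat"
    and u\<^sub>0 :: "real ^ 'd \<Rightarrow> real"
    and u :: "real \<Rightarrow> 'w \<Rightarrow> real ^ 'd \<Rightarrow> real"
  assumes "prob_space M"
    and "0 < \<epsilon>" and "\<epsilon> < 1" and "1 / \<epsilon> \<in> \<nat>"
    and "iid_poisson_processes M (1 / \<epsilon>\<^sup>2) (UNIV \<times> torus \<epsilon>) (\<lambda>(i, x). N i x)"
    and "averaging_process M \<epsilon> N u\<^sub>0 u"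
    and "t > 0"
  shows "integrable M (\<lambda>\<omega>. (H1_norm \<epsilon> (u t \<omega>))\<^sup>2) \<and>
    (\<integral>\<omega>. (H1_norm \<epsilon> (u t \<omega>))\<^sup>2 \<partial>M) \<le> 2 * (H1_norm \<epsilon> u\<^sub>0)\<^sup>2"
proof -
  interpret prob_space M by fact
  note \<epsilon> = assms(2-4)
  interpret T: torus_shifts "torus \<epsilon> :: (real ^ 'd) set" "shift \<epsilon>" torus_add
    by (rule torus_shifts_torus[OF \<epsilon>])
  define f where "f \<omega> = T.energy (u t \<omega>)" for \<omega>
  define K where "K = 4 * CARD('d) * (\<Sum>x\<in>torus \<epsilon>. (u\<^sub>0 x)\<^sup>2)"
  \<comment> \<open>The expected total number of rings up to time \<open>t\<close>.\<close>
  define a where "a = t / \<epsilon>\<^sup>2 * card (T.bonds :: ('d \<times> (real ^ 'd)) set)"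
  define ev where "ev m as = {\<omega>\<in>space M. \<forall>b\<in>T.bonds. \<forall>k<m.
      (case b of (i, x) \<Rightarrow> N i x) (real (Suc k) * (t / real m)) \<omega> -
      (case b of (i, x) \<Rightarrow> N i x) (real k * (t / real m)) \<omega> = (if as ! k = Some b then 1 else 0)}"
    for m as
  have iid: "iid_poisson_processes M (1 / \<epsilon>\<^sup>2) T.bonds (\<lambda>(i, x). N i x)"
    using assms(5) by (simp add: T.bonds_def)
  have bonds_ne: "T.bonds \<noteq> {}"
    using T.V_nonempty by (auto simp: T.bonds_def)

  have f_meas [measurable]: "f \<in> borel_measurable M"
    unfolding f_def T.energy_def using assms(6,7) T.shift_closed
    by (intro borel_measurable_sum borel_measurable_power borel_measurable_diff)
      (auto simp: averaging_process_def)

  have clocks: "AE \<omega> in M. \<forall>b\<in>T.bonds. case b of (i, x) \<Rightarrow>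
      mono_on {0..} (\<lambda>t. N i x t \<omega>) \<and> (\<forall>t\<ge>0. continuous (at_right t) (\<lambda>s. N i x s \<omega>))"
    using iid unfolding iid_poisson_processes_def poisson_process_def
    by (intro AE_finite_allI T.finite_bonds) (fastforce elim!: eventually_mono)
  have path: "AE \<omega> in M. averaging_path \<epsilon> (\<lambda>i x t. N i x t \<omega>) u\<^sub>0 (\<lambda>t. u t \<omega>)"
    using assms(6) by (simp add: averaging_process_def)
  \<comment> \<open>One null set serves all \<open>m\<close> and \<open>as\<close> at once, since it
    depends only on the paths.\<close>
  have on_ev: "AE \<omega> in M. \<forall>m as. 0 < m \<longrightarrow> as \<in> T.words m \<longrightarrow> \<omega> \<in> ev m as \<longrightarrow>
      f \<omega> = T.energy (T.run as u\<^sub>0)"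
    using clocks path
  proof eventually_elim
    case (elim \<omega>)
    show ?case
    proof (intro allI impI)
      fix m as assume m: "0 < m" and as: "as \<in> T.words m" and \<omega>: "\<omega> \<in> ev m as"
      have "u (real (length as) * (t / m)) \<omega> y = T.run as u\<^sub>0 y" if "y \<in> torus \<epsilon>" for y
      proof (rule averaging_path_run[OF \<epsilon> elim(2)])
        fix i k and x :: "real ^ 'd" assume "x \<in> torus \<epsilon>" "k < length as"
        then show "N i x (real (Suc k) * (t / m)) \<omega> - N i x (real k * (t / m)) \<omega> =
            (if as ! k = Some (i, x) then 1 else 0)"
          using \<omega> as unfolding ev_def by (auto simp: T.words_def T.bonds_def)
      qed (use elim(1) m as that assms(7) in \<open>auto simp: T.bonds_def T.words_def\<close>)
      then show "f \<omega> = T.energy (T.run as u\<^sub>0)"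
        unfolding f_def using m as by (intro T.energy_cong) (simp add: T.words_def)
    qed
  qed

  have ev_sets: "ev m as \<in> events" if "0 < m" for m as
    unfolding ev_def using that assms(7)
    by (intro iid_poisson_processes_increments(1)[OF \<open>prob_space M\<close> iid T.finite_bonds bonds_ne]) auto
  \<comment> \<open>The increments determine every letter, so the events of distinct words of equal
    length are disjoint.\<close>
  have disj: "as = bs" if "as \<in> T.words m" "bs \<in> T.words m" "\<omega> \<in> ev m as" "\<omega> \<in> ev m bs" for as bs m \<omega>
  proof (rule nth_equalityI)
    show "length as = length bs"
      using that by (simp add: T.words_def)
    fix k assume k: "k < length as"
    have "as ! k \<in> T.letters" "bs ! k \<in> T.letters"
      using that(1,2) k unfolding T.words_def mem_Collect_eq by (metis nth_mem subsetD)+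
    moreover have "as ! k = Some b \<longleftrightarrow> bs ! k = Some b" if "b \<in> T.bonds" for b
    proof -
      have "k < m"
        using k \<open>as \<in> T.words m\<close> by (simp add: T.words_def)
      then have "(if as ! k = Some b then 1 else 0 :: nat) = (if bs ! k = Some b then 1 else 0)"
        using \<open>\<omega> \<in> ev m as\<close> \<open>\<omega> \<in> ev m bs\<close> that unfolding ev_def mem_Collect_eq by metis
      then show ?thesis
        by (auto split: if_splits)
    qed
    ultimately show "as ! k = bs ! k"
      unfolding T.letters_def by (metis imageE insertE)
  qed
  \<comment> \<open>The probability that none of the \<open>m\<close> intervals contains two or more
    rings.\<close>
  define q where "q m = (1 + a / real m) ^ m * exp (- a)" for m
  have prob_ev: "\<exists>v w :: real. 0 \<le> v \<and> 0 \<le> w \<and> v + card (T.bonds :: ('d \<times> (real ^ 'd)) set) * w \<le> 1 \<and>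
      (v + card (T.bonds :: ('d \<times> (real ^ 'd)) set) * w) ^ m = q m \<and>
      (\<forall>as\<in>T.words m. prob (ev m as) = T.weight v w as)" if m: "0 < m" for m
  proof -
    define L where "L = 1 / \<epsilon>\<^sup>2 * (t / real m)"
    define B where "B = card (T.bonds :: ('d \<times> (real ^ 'd)) set)"
    have L: "0 < L"
      unfolding L_def using assms(2,7) m by simp
    have BL: "real B * L = a / m"
      unfolding L_def B_def a_def by simp
    have sum: "exp (- L) ^ B + B * (L * exp (- L) ^ B) = (1 + a / m) * exp (- (a / m))"
      unfolding BL[symmetric] by (simp add: exp_of_nat_mult[symmetric] algebra_simps)
    \<comment> \<open>The inequality \<open>1 + x \<le> exp x\<close> bounds the total weight per
      letter by 1.\<close>
    have "(1 + a / m) * exp (- (a / m)) \<le> exp (a / m) * exp (- (a / m))"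
      by (intro mult_right_mono exp_ge_add_one_self) auto
    then have "exp (- L) ^ B + B * (L * exp (- L) ^ B) \<le> 1"
      unfolding sum by (simp add: exp_minus)
    moreover have "(exp (- L) ^ B + B * (L * exp (- L) ^ B)) ^ m = q m"
      unfolding sum q_def power_mult_distrib using m by (simp flip: exp_of_nat_mult)
    moreover have "prob (ev m as) = T.weight (exp (- L) ^ B) (L * exp (- L) ^ B) as"
      if "as \<in> T.words m" for as
    proof -
      have "prob (ev m as) =
          (\<Prod>b\<in>T.bonds. \<Prod>k<m. pmf (poisson_pmf L) (if as ! k = Some b then 1 else 0))"
        unfolding ev_def L_def using m assms(7)
        by (intro iid_poisson_processes_increments(2)[OF \<open>prob_space M\<close> iid T.finite_bonds bonds_ne])
          auto
      also have "\<dots> = T.weight (exp (- L) ^ B) (L * exp (- L) ^ B) as"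
        unfolding B_def by (rule T.prod_poisson_weight[OF that L])
      finally show ?thesis .
    qed
    ultimately show ?thesis
      unfolding B_def using L
      by (intro exI[of _ "exp (- L) ^ card (T.bonds :: ('d \<times> (real ^ 'd)) set)"]
          exI[of _ "L * exp (- L) ^ card (T.bonds :: ('d \<times> (real ^ 'd)) set)"]) simp
  qed
  have sum_prob: "(\<Sum>as\<in>T.words m. prob (ev m as)) = q m" if "0 < m" for m
    using prob_ev[OF that] by (metis (no_types, lifting) T.sum_weight sum.cong)
  have sum_energy: "(\<Sum>as\<in>T.words m. T.energy (T.run as u\<^sub>0) * prob (ev m as)) \<le> 2 * T.energy u\<^sub>0"
    if m: "0 < m" for m
  proof -
    obtain v w :: real where "0 \<le> v" "0 \<le> w" "v + card (T.bonds :: ('d \<times> (real ^ 'd)) set) * w \<le> 1"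
      and p: "\<forall>as\<in>T.words m. prob (ev m as) = T.weight v w as"
      using prob_ev[OF m] by blast
    from T.sum_weight_energy_le[OF this(1-3), where m = m and u = u\<^sub>0] p show ?thesis
      by (simp add: mult.commute)
  qed
  have q_lim: "q \<longlonglongrightarrow> 1"
    using tendsto_mult[OF tendsto_exp_limit_sequentially[of a] tendsto_const[of "exp (- a)"]]
    by (simp add: q_def[abs_def] flip: exp_add)

  have union: "prob (\<Union>as\<in>T.words m. ev m as) = q m" if "0 < m" for m
    unfolding sum_prob[OF that, symmetric] using disj ev_sets[OF that] T.finite_words
    by (intro finite_measure_finite_Union) (auto simp: disjoint_family_on_def)
  \<comment> \<open>On \<open>U\<close> some subdivision separates all rings. As
    \<open>prob U\<close> dominates every \<open>q m\<close>, it equals 1, so almost surely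
    \<open>u t\<close> is the result of a word; this yields the bound \<open>K\<close> and
    integrability.\<close>
  define U where "U = (\<Union>m\<in>{0<..}. \<Union>as\<in>T.words m. ev m as)"
  have U_sets: "U \<in> events"
    unfolding U_def using ev_sets T.finite_words
    by (intro sets.countable_UN' sets.finite_UN) auto
  have "q m \<le> prob U" if m: "0 < m" for m
  proof -
    have "(\<Union>as\<in>T.words m. ev m as) \<subseteq> U"
      unfolding U_def by (rule UN_upper) (simp add: m)
    then show ?thesis
      unfolding union[OF m, symmetric] using U_sets by (rule finite_measure_mono)
  qed
  then have "1 \<le> prob U"
    by (intro LIMSEQ_le_const2[OF q_lim] exI[of _ 1]) simp
  then have "AE \<omega> in M. \<omega> \<in> U"
    using U_sets prob_le_1[of U] by (intro AE_prob_1) simp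
  then have f_le: "AE \<omega> in M. f \<omega> \<le> K"
    using on_ev
  proof eventually_elim
    case (elim \<omega>)
    then obtain m as where "0 < m" "as \<in> T.words m" "\<omega> \<in> ev m as"
      by (auto simp: U_def)
    then have "f \<omega> = T.energy (T.run as u\<^sub>0)" "set as \<subseteq> T.letters"
      using elim(2) by (auto simp: T.words_def)
    moreover have "4 * CARD('d) * (\<Sum>x\<in>torus \<epsilon>. (T.run as u\<^sub>0 x)\<^sup>2) \<le> K"
      unfolding K_def using calculation(2) by (intro mult_left_mono T.sum_square_run_le) auto
    ultimately show ?case
      using T.energy_le[of "T.run as u\<^sub>0"] by simp
  qed
  have f_nonneg: "f \<omega> \<ge> 0" for \<omega>
    unfolding f_def by (rule T.energy_nonneg)
  have int_f: "integrable M f"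
    using f_le f_nonneg by (intro integrable_const_bound[of _ K]) (auto elim: eventually_mono)

  have bound: "(\<integral>\<omega>. f \<omega> \<partial>M) \<le> 2 * T.energy u\<^sub>0 + K * (1 - q m)" if m: "0 < m" for m
  proof -
    \<comment> \<open>\<open>?g\<close> is the energy of the word when the increments spell one, and
      the bound \<open>K\<close> otherwise.\<close>
    let ?g = "\<lambda>\<omega>. (\<Sum>as\<in>T.words m. T.energy (T.run as u\<^sub>0) * indicator (ev m as) \<omega>) +
      K * (1 - (\<Sum>as\<in>T.words m. indicator (ev m as) \<omega>))"
    have int_ind: "integrable M (indicator (ev m as) :: _ \<Rightarrow> real)" for as
      using ev_sets[OF m] by (intro integrable_real_indicator) (auto simp: emeasure_eq_measure)
    have "(\<integral>\<omega>. f \<omega> \<partial>M) \<le> (\<integral>\<omega>. ?g \<omega> \<partial>M)"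
    proof (rule integral_mono_AE[OF int_f])
      show "integrable M ?g"
        using int_ind by (intro Bochner_Integration.integrable_add integrable_mult_right
            Bochner_Integration.integrable_diff Bochner_Integration.integrable_sum) auto
      show "AE \<omega> in M. f \<omega> \<le> ?g \<omega>"
        using on_ev f_le
      proof eventually_elim
        case (elim \<omega>)
        show ?case
        proof (cases "\<exists>as\<in>T.words m. \<omega> \<in> ev m as")
          case True
          then obtain as where as: "as \<in> T.words m" "\<omega> \<in> ev m as"
            by blast
          \<comment> \<open>Used twice: with the energies and with the constant 1.\<close>
          have "(\<Sum>bs\<in>T.words m. F bs * indicator (ev m bs) \<omega>) = F as" for F :: "_ \<Rightarrow> real"
          proof -
            have "(\<Sum>bs\<in>T.words m. F bs * indicator (ev m bs) \<omega>) =
                (\<Sum>bs\<in>T.words m. if bs = as then F bs else 0)"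
            proof (rule sum.cong[OF refl])
              fix bs assume "bs \<in> T.words m"
              then have "\<omega> \<in> ev m bs \<longleftrightarrow> bs = as"
                using as disj by blast
              then show "F bs * indicator (ev m bs) \<omega> = (if bs = as then F bs else 0)"
                by (simp add: indicator_def)
            qed
            then show ?thesis
              using as T.finite_words by simp
          qed
          from this[of "\<lambda>bs. T.energy (T.run bs u\<^sub>0)"] this[of "\<lambda>_. 1"] show ?thesis
            using elim(1) m as by simp
        qed (use elim(2) in \<open>simp add: indicator_def\<close>)
      qed
    qed
    also have "\<dots> = (\<Sum>as\<in>T.words m. T.energy (T.run as u\<^sub>0) * prob (ev m as)) +
        K * (1 - (\<Sum>as\<in>T.words m. prob (ev m as)))"
      using int_ind ev_sets[OF m] by (simp add: prob_space)
    finally show ?thesis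
      using sum_energy[OF m] sum_prob[OF m] by simp
  qed
  \<comment> \<open>Letting \<open>m\<close> tend to infinity removes the contribution of unresolved
    rings.\<close>
  have "(\<integral>\<omega>. f \<omega> \<partial>M) \<le> 2 * T.energy u\<^sub>0 + K * (1 - 1)"
    by (rule LIMSEQ_le_const[OF tendsto_add[OF tendsto_const tendsto_mult[OF tendsto_const
            tendsto_diff[OF tendsto_const q_lim]]]])
      (use bound in \<open>auto intro: exI[of _ 1]\<close>)
  moreover have "0 \<le> \<epsilon> ^ CARD('d) / \<epsilon>\<^sup>2"
    using \<epsilon> by simp
  ultimately have "\<epsilon> ^ CARD('d) / \<epsilon>\<^sup>2 * (\<integral>\<omega>. f \<omega> \<partial>M) \<le> \<epsilon> ^ CARD('d) / \<epsilon>\<^sup>2 * (2 * T.energy u\<^sub>0)"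
    by (intro mult_left_mono) simp_all
  then show ?thesis
    using int_f unfolding H1_norm_square[OF \<epsilon>] f_def by (simp add: mult.left_commute)
qed

end
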